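(* Let $0\le\alpha<1$ and let $h(z)=z+\sum_{n=2}^{\infty}a_nz^n$ and $g(z)=\sum_{n=1}^{\infty}b_nz^n$ be power series whose coefficients satisfy (with $a_1=1$) $$|a_n|\le\frac{n+1}{2}\quad\text{and}\quad |b_n|\le\frac{n-1}{2}\qquad\text{for all } n\ge1.$$ Then $f=h+\overline{g}$ is univalent and fully starlike of order $\alpha$ in the disk $|z|<r_S$, where $r_S=r_S(\alpha)$ is the real root of the equation $$(2-\alpha)(1-r)^3+\alpha r(1-r)^2-1-r=0$$ in the interval $(0,1)$. Moreover, this result is sharp for each $\alpha\in[0,1)$: for each such $\alpha$, $r_S(\alpha)$ cannot be replaced by any larger number.
   Context: A complex-valued harmonic function $f$ with $f(0)=0$ is said to be fully starlike of order $\alpha$ ($0\le\alpha<1$) in a disk $|z|<\rho$ if, for every $0<r<\rho$, $f$ maps the circle $|z|=r$ in a one-to-one manner onto a curve that bounds a domain starlike with respect to the origin and satisfies $\frac{\partial}{\partial\theta}\arg f(re^{i\theta})>\alpha$ for $0\le\theta\le2\pi$. Fully starlike means fully starlike of order $0$. *)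

theory Defs
  imports "HOL-Complex_Analysis.Complex_Analysis"
begin

(* Complex-valued harmonic functions: twice continuously differentiable in the real sense,
   with vanishing Laplacian; fx, fy, fxx, ... are the partial derivatives with respect to
   the real and imaginary part of the argument. *)
definition harmonic_on :: "(complex \<Rightarrow> complex) \<Rightarrow> complex set \<Rightarrow> bool" where
  "harmonic_on f S \<longleftrightarrow> open S \<and>
     (\<exists>fx fy fxx fxy fyx fyy.
        (\<forall>z\<in>S. (f has_derivative (\<lambda>w. Re w *\<^sub>R fx z + Im w *\<^sub>R fy z)) (at z) \<and>
               (fx has_derivative (\<lambda>w. Re w *\<^sub>R fxx z + Im w *\<^sub>R fxy z)) (at z) \<and>
               (fy has_derivative (\<lambda>w. Re w *\<^sub>R fyx z + Im w *\<^sub>R fyy z)) (at z)) \<and>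
        continuous_on S fxx \<and> continuous_on S fxy \<and>
        continuous_on S fyx \<and> continuous_on S fyy \<and>
        (\<forall>z\<in>S. fxx z + fyy z = 0))"

definition bounds_starlike_domain :: "complex set \<Rightarrow> bool" where
  "bounds_starlike_domain C \<longleftrightarrow>
     (\<exists>D. open D \<and> connected D \<and> bounded D \<and> frontier D = C \<and>
          0 \<in> D \<and> (\<forall>w\<in>D. closed_segment 0 w \<subseteq> D))"

(* The argument of f along the circle of radius r is multivalued; phi is a differentiable
   branch of it over the real line. Two such branches differ by a constant, so that the
   derivative does not depend on the choice of phi. *)
definition arg_derivative_greater :: "real \<Rightarrow> (complex \<Rightarrow> complex) \<Rightarrow> real \<Rightarrow> bool" where
  "arg_derivative_greater \<alpha> f r \<longleftrightarrow>
     (\<exists>\<phi> \<phi>' :: real \<Rightarrow> real.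
        (\<forall>\<theta>. f (rcis r \<theta>) \<noteq> 0 \<and>
             f (rcis r \<theta>) = rcis (cmod (f (rcis r \<theta>))) (\<phi> \<theta>) \<and>
             (\<phi> has_real_derivative \<phi>' \<theta>) (at \<theta>)) \<and>
        (\<forall>\<theta>\<in>{0..2 * pi}. \<alpha> < \<phi>' \<theta>))"

(* fully starlike of order alpha in the disk of radius rho about the origin *)
definition fully_starlike :: "real \<Rightarrow> (complex \<Rightarrow> complex) \<Rightarrow> real \<Rightarrow> bool" where
  "fully_starlike \<alpha> f \<rho> \<longleftrightarrow>
     harmonic_on f (ball 0 \<rho>) \<and> f 0 = 0 \<and>
     (\<forall>r. 0 < r \<and> r < \<rho> \<longrightarrow>
        inj_on f (sphere 0 r) \<and>
        bounds_starlike_domain (f ` sphere 0 r) \<and>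
        arg_derivative_greater \<alpha> f r)"

definition coeff_bounds :: "complex fps \<Rightarrow> complex fps \<Rightarrow> bool" where
  "coeff_bounds h g \<longleftrightarrow>
     fps_nth h 0 = 0 \<and> fps_nth h 1 = 1 \<and> fps_nth g 0 = 0 \<and>
     (\<forall>n\<ge>1. cmod (fps_nth h n) \<le> (real n + 1) / 2 \<and>
             cmod (fps_nth g n) \<le> (real n - 1) / 2)"

definition harmonic_map :: "complex fps \<Rightarrow> complex fps \<Rightarrow> complex \<Rightarrow> complex" where
  "harmonic_map h g z = eval_fps h z + cnj (eval_fps g z)"

definition is_rS :: "real \<Rightarrow> real \<Rightarrow> bool" where
  "is_rS \<alpha> r \<longleftrightarrow> 0 < r \<and> r < 1 \<and>
     (2 - \<alpha>) * (1 - r) ^ 3 + \<alpha> * r * (1 - r) ^ 2 - 1 - r = 0"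

(* Meaningful for 0 <= alpha < 1, where the root exists and is unique. *)
definition rS :: "real \<Rightarrow> real" where
  "rS \<alpha> = (THE r. is_rS \<alpha> r)"

end

theory Submission
  imports Defs
begin

text \<open>
  Everything rests on two comparisons of power series. Write $f = h + \overline g$ and
  $A = z h' - \overline{z g'}$, so that $\partial f/\partial\theta = i A$ on circles about the
  origin and $\partial(\arg f)/\partial\theta = \mathrm{Re}(A/f)$. Summing the coefficient bounds,
  the inequality
  $$\sum_{n \ge 2} \bigl((n-\alpha)|a_n| + (n+\alpha)|b_n|\bigr) r^{n-1}
     \le \sum_{n \ge 2} (n^2-\alpha) r^{n-1} < 1 - \alpha$$
  holds exactly as long as the polynomial that defines $r_S$ is positive at $r$
  (\<open>rS_poly_closed_form\<close>), that is, for $r < r_S$.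

  The first comparison bounds the difference quotient of $f - \mathrm{id}$ in $|z| \le r$ by
  $\sum_{n \ge 2} n^2 r^{n-1} < 1$ (\<open>harmonic_map_near_identity_strict\<close>). It gives univalence at
  once, and also $\mathrm{Re}(f(z)/z) > 0$. The second comparison is
  $|A - f| < |A + (1-2\alpha) f|$, which says that $A/f$ is nearer to $1$ than to $2\alpha - 1$,
  hence that $\mathrm{Re}(A/f) > \alpha$ (\<open>Re_rotational_deriv_quotient_gt\<close>).

  Since $f(z)/z$ lies in the right half-plane, $\theta + \mathrm{Im}\,\mathrm{Ln}(f(z)/z)$ is a
  smooth branch of $\arg f$ that increases by exactly $2\pi$ over one turn. It is strictly
  monotone by the second comparison, so the image of the circle meets every ray from the origin
  at most once (\<open>circle_image_meets_ray_once\<close>). The image of the disk is open by invariance of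
  domain, with the image of the circle as its frontier, and a segment from the origin that left
  it would force two frontier points onto one ray (\<open>bounds_starlike_domain_image\<close>).

  For sharpness take $a_n = -(n+1)/2$ for $n \ge 2$ and $b_n = (n-1)/2$. On the positive axis
  every term of the sum above then counts fully, and at $z = r_S$ one gets $A = \alpha f$ with $f$
  real. So the derivative of the argument equals $\alpha$ there, and the circle of radius $r_S$
  already violates the strict inequality.
\<close>

section \<open>Majorants with quadratically growing coefficients\<close>

lemma sums_squares_geometric:
  fixes r d :: real
  assumes "\<bar>r\<bar> < 1"
  shows "(\<lambda>n. (real n ^ 2 + d) * r ^ n) sums (r * (1 + r) / (1 - r) ^ 3 + d / (1 - r))"
proof -
  have r: "norm r < 1" and [simp]: "1 - r \<noteq> 0" using assms by auto
  \<comment> \<open>The square is a combination of $(n+1)(n+2)$, $n+1$ and $1$, which are the coefficients of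
    the derivatives of the geometric series.\<close>
  have d1: "(\<lambda>n. real (Suc n) * x ^ n) sums (1 / (1 - x) ^ 2)" if "norm x < 1" for x :: real
    using geometric_deriv_sums[OF that] by simp
  have "((\<lambda>x. 1 / (1 - x) ^ 2) has_field_derivative
      (0 * (1 - r) ^ 2 - 1 * (2 * (1 - r) * (- 1))) / ((1 - r) ^ 2 * (1 - r) ^ 2)) (at r)"
    using assms by (auto intro!: derivative_eq_intros)
  also have "(0 * (1 - r) ^ 2 - 1 * (2 * (1 - r) * (- 1))) / ((1 - r) ^ 2 * (1 - r) ^ 2)
      = 2 / (1 - r) ^ 3"
  proof -
    have eq: "(0 * s ^ 2 - 1 * (2 * s * (- 1))) / (s ^ 2 * s ^ 2) = 2 / s ^ 3" if "s \<noteq> 0" for s :: real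
      using that by (simp add: field_simps eval_nat_numeral)
    show ?thesis by (rule eq) (use assms in auto)
  qed
  finally have "((\<lambda>x. 1 / (1 - x) ^ 2) has_field_derivative 2 / (1 - r) ^ 3) (at r)" .
  from termdiffs_sums_strong[OF d1 this r]
  have d2: "(\<lambda>n. real (Suc n) * real (Suc (Suc n)) * r ^ n) sums (2 / (1 - r) ^ 3)"
    by (simp add: diffs_def)
  have "(\<lambda>n. real (Suc n) * real (Suc (Suc n)) * r ^ n - 3 * (real (Suc n) * r ^ n)
          + (1 + d) * r ^ n) sums
        (2 / (1 - r) ^ 3 - 3 * (1 / (1 - r) ^ 2) + (1 + d) * (1 / (1 - r)))"
    by (intro sums_add sums_diff sums_mult d1 d2 geometric_sums r)
  also have "(\<lambda>n. real (Suc n) * real (Suc (Suc n)) * r ^ n - 3 * (real (Suc n) * r ^ n)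
          + (1 + d) * r ^ n) = (\<lambda>n. (real n ^ 2 + d) * r ^ n)"
    by (auto simp: algebra_simps power2_eq_square)
  also have "2 / (1 - r) ^ 3 - 3 * (1 / (1 - r) ^ 2) + (1 + d) * (1 / (1 - r))
      = r * (1 + r) / (1 - r) ^ 3 + d / (1 - r)"
  proof -
    define s where "s = 1 - r"
    have s: "s \<noteq> 0" "r = 1 - s" using assms by (auto simp: s_def)
    show ?thesis unfolding s_def[symmetric] unfolding s(2) using s(1)
      by (simp add: field_simps eval_nat_numeral)
  qed
  finally show ?thesis .
qed

text \<open>
  The common shape of all the estimates below: the term of index $1$ is split off as the main
  part, and the rest is majorized by a series with the closed form above. The weight $n^2 + d$
  covers the three series in use, with $d = 0$, $d = -1$ and $d = 1 - 2\alpha$.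
\<close>

lemma norm_series_tail_le:
  fixes F :: "nat \<Rightarrow> complex" and r d K :: real
  assumes sums: "F sums s" and r: "\<bar>r\<bar> < 1" and F0: "F 0 = 0"
    and le: "\<And>n. n \<ge> 2 \<Longrightarrow> cmod (F n) \<le> K * ((real n ^ 2 + d) * r ^ n)"
  shows "cmod (s - F 1) \<le> K * (r * (1 + r) / (1 - r) ^ 3 + d * r / (1 - r) - (1 + d) * r)"
proof -
  let ?c = "\<lambda>n. (real n ^ 2 + d) * r ^ n"
  have "(\<lambda>n. F n - (if n = 1 then F n else 0)) sums (s - F 1)"
    by (intro sums_diff sums sums_single)
  moreover have "(\<lambda>n. K * (?c n - (if n = 0 then ?c n else 0) - (if n = 1 then ?c n else 0)))
      sums (K * (r * (1 + r) / (1 - r) ^ 3 + d / (1 - r) - ?c 0 - ?c 1))"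
    by (intro sums_diff sums_mult sums_single sums_squares_geometric r)
  moreover have "cmod (F n - (if n = 1 then F n else 0))
      \<le> K * (?c n - (if n = 0 then ?c n else 0) - (if n = 1 then ?c n else 0))" for n
  proof -
    consider "n = 0" | "n = 1" | "n \<ge> 2" by linarith
    then show ?thesis using le[of n] F0 by cases auto
  qed
  ultimately have "cmod (s - F 1) \<le> K * (r * (1 + r) / (1 - r) ^ 3 + d / (1 - r) - ?c 0 - ?c 1)"
    by (metis (no_types, lifting) norm_sums_le)
  also have "r * (1 + r) / (1 - r) ^ 3 + d / (1 - r) - ?c 0 - ?c 1
      = r * (1 + r) / (1 - r) ^ 3 + d * r / (1 - r) - (1 + d) * r"
  proof -
    have "d / (1 - r) - d = d * r / (1 - r)" using r by (simp add: field_simps)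
    then show ?thesis by simp
  qed
  finally show ?thesis .
qed

section \<open>The radius of full starlikeness\<close>

definition rS_poly :: "real \<Rightarrow> real \<Rightarrow> real" where
  "rS_poly \<alpha> r = (2 - \<alpha>) * (1 - r) ^ 3 + \<alpha> * r * (1 - r) ^ 2 - 1 - r"

lemma is_rS_iff: "is_rS \<alpha> r \<longleftrightarrow> 0 < r \<and> r < 1 \<and> rS_poly \<alpha> r = 0"
  by (simp add: is_rS_def rS_poly_def)

lemma rS_poly_strict_decreasing:
  assumes "0 \<le> \<alpha>" "\<alpha> < 1" "0 \<le> x" "x < y" "y \<le> 1"
  shows "rS_poly \<alpha> y < rS_poly \<alpha> x"
proof (rule DERIV_neg_imp_decreasing[OF \<open>x < y\<close>])
  fix t assume t: "x \<le> t" "t \<le> y"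
  let ?D = "(4 * \<alpha> - 6) * (1 - t) ^ 2 - 2 * \<alpha> * t * (1 - t) - 1"
  have "(rS_poly \<alpha> has_real_derivative ?D) (at t)"
    unfolding rS_poly_def
    by (auto intro!: derivative_eq_intros simp: algebra_simps power2_eq_square)
  moreover have "(4 * \<alpha> - 6) * (1 - t) ^ 2 \<le> 0"
    using assms by (intro mult_nonpos_nonneg) auto
  moreover have "0 \<le> 2 * \<alpha> * t * (1 - t)" using assms t by auto
  ultimately show "\<exists>y. DERIV (rS_poly \<alpha>) t :> y \<and> y < 0"
    by (intro exI[of _ ?D]) auto
qed

lemma ex1_is_rS:
  assumes "0 \<le> \<alpha>" "\<alpha> < 1"
  shows "\<exists>!r. is_rS \<alpha> r"
proof -
  have "continuous_on {0..1} (rS_poly \<alpha>)"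
    unfolding rS_poly_def by (intro continuous_intros)
  moreover have "rS_poly \<alpha> 1 \<le> 0" "0 \<le> rS_poly \<alpha> 0" "rS_poly \<alpha> 1 \<noteq> 0" "rS_poly \<alpha> 0 \<noteq> 0"
    using assms by (auto simp: rS_poly_def)
  ultimately obtain r where "0 \<le> r" "r \<le> 1" "rS_poly \<alpha> r = 0" "r \<noteq> 0" "r \<noteq> 1"
    using IVT2'[of "rS_poly \<alpha>" 1 0 0] by fastforce
  then have "is_rS \<alpha> r" by (simp add: is_rS_iff)
  moreover have "x = y" if "is_rS \<alpha> x" "is_rS \<alpha> y" for x y
    using that assms rS_poly_strict_decreasing[of \<alpha> x y] rS_poly_strict_decreasing[of \<alpha> y x]
    by (cases x y rule: linorder_cases) (auto simp: is_rS_iff)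
  ultimately show ?thesis by blast
qed

lemma is_rS_rS:
  assumes "0 \<le> \<alpha>" "\<alpha> < 1"
  shows "is_rS \<alpha> (rS \<alpha>)"
  unfolding rS_def using theI'[OF ex1_is_rS[OF assms]] .

text \<open>
  This identity links the radius to the coefficients: its left side is $r$ times the excess of
  $1 - \alpha$ over $\sum_{n \ge 2} (n^2 - \alpha) r^{n-1}$.
\<close>

lemma rS_poly_closed_form:
  assumes "r < 1"
  shows "2 * (1 - \<alpha>) * r - (r * (1 + r) / (1 - r) ^ 3 - \<alpha> * r / (1 - r))
    = r * rS_poly \<alpha> r / (1 - r) ^ 3"
proof -
  define s where "s = 1 - r"
  have s: "s \<noteq> 0" "r = 1 - s" using assms by (auto simp: s_def)
  show ?thesis unfolding rS_poly_def s_def[symmetric] unfolding s(2) using s(1)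
    by (simp add: field_simps eval_nat_numeral)
qed

text \<open>
  The first inequality is what full starlikeness of order $\alpha$ uses, the second is what
  univalence uses. The second follows from the first because
  $n^2 - \alpha \ge (1 - \alpha) n^2$, here in summed form.
\<close>

lemma coefficient_majorant_less:
  assumes "0 \<le> \<alpha>" "\<alpha> < 1" "0 < r" "r < rS \<alpha>"
  shows "r * (1 + r) / (1 - r) ^ 3 - \<alpha> * r / (1 - r) < 2 * (1 - \<alpha>) * r"
    and "r * (1 + r) / (1 - r) ^ 3 < 2 * r"
proof -
  have R: "0 < rS \<alpha>" "rS \<alpha> < 1" "rS_poly \<alpha> (rS \<alpha>) = 0"
    using is_rS_rS[OF assms(1,2)] by (auto simp: is_rS_iff)
  then have "0 < rS_poly \<alpha> r"
    using rS_poly_strict_decreasing[of \<alpha> r "rS \<alpha>"] assms by auto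
  then have "0 < r * rS_poly \<alpha> r / (1 - r) ^ 3" using assms R by auto
  with rS_poly_closed_form[of r \<alpha>] assms R
  show 1: "r * (1 + r) / (1 - r) ^ 3 - \<alpha> * r / (1 - r) < 2 * (1 - \<alpha>) * r" by linarith
  have "r / (1 - r) \<le> r * (1 + r) / (1 - r) ^ 3"
  proof -
    have "(1 - r) ^ 2 \<le> 1 ^ 2" using assms R by (intro power_mono) auto
    then have "(1 - r) ^ 2 \<le> 1 + r" using assms by simp
    then have "r * (1 - r) ^ 2 / (1 - r) ^ 3 \<le> r * (1 + r) / (1 - r) ^ 3"
      using assms R by (intro divide_right_mono mult_left_mono) auto
    then show ?thesis using assms R by (simp add: eval_nat_numeral)
  qed
  then have "\<alpha> * (r / (1 - r)) \<le> \<alpha> * (r * (1 + r) / (1 - r) ^ 3)"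
    by (intro mult_left_mono assms)
  moreover have "(1 - \<alpha>) * M < (1 - \<alpha>) * (2 * r)"
    if "M - \<alpha> * G < 2 * (1 - \<alpha>) * r" "\<alpha> * G \<le> \<alpha> * M" for M G :: real
    using that by (simp add: algebra_simps)
  ultimately have "(1 - \<alpha>) * (r * (1 + r) / (1 - r) ^ 3) < (1 - \<alpha>) * (2 * r)"
    using 1 by (simp only: times_divide_eq_right[symmetric])
  then show "r * (1 + r) / (1 - r) ^ 3 < 2 * r"
    by (rule mult_left_less_imp_less) (use assms in auto)
qed

section \<open>Power series with the coefficient bounds\<close>

lemma fps_conv_radius_ge_1:
  fixes a :: "complex fps"
  assumes "\<And>n. n \<ge> 1 \<Longrightarrow> cmod (fps_nth a n) \<le> real n"
  shows "fps_conv_radius a \<ge> 1"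
  unfolding fps_conv_radius_def
proof (rule conv_radius_geI_ex')
  fix r :: real assume r: "0 < r" "ereal r < 1"
  then have "summable (\<lambda>n. (real n ^ 2 + 0) * r ^ n)"
    by (intro sums_summable[OF sums_squares_geometric]) auto
  then show "summable (\<lambda>n. fps_nth a n * complex_of_real r ^ n)"
  proof (rule summable_comparison_test'[where N = 1])
    fix n :: nat assume n: "n \<ge> 1"
    have "cmod (fps_nth a n) \<le> real n ^ 2"
      using assms[OF n] n by (auto simp: power2_eq_square intro: order_trans)
    then show "norm (fps_nth a n * complex_of_real r ^ n) \<le> (real n ^ 2 + 0) * r ^ n"
      using r by (auto simp: norm_mult norm_power intro: mult_right_mono)
  qed
qed

lemma coeff_boundsD:
  assumes "coeff_bounds h g"
  shows "fps_nth h 0 = 0" "fps_nth h 1 = 1" "fps_nth g 0 = 0" "fps_nth g 1 = 0"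
    and "n \<ge> 1 \<Longrightarrow> cmod (fps_nth h n) \<le> (real n + 1) / 2"
    and "n \<ge> 1 \<Longrightarrow> cmod (fps_nth g n) \<le> (real n - 1) / 2"
proof -
  have "cmod (fps_nth g 1) \<le> (real 1 - 1) / 2"
    using assms unfolding coeff_bounds_def by blast
  then show "fps_nth g 1 = 0" by simp
qed (use assms in \<open>auto simp: coeff_bounds_def\<close>)

lemma conv_radius_coeff_bounds:
  assumes "coeff_bounds h g"
  shows "fps_conv_radius h \<ge> 1" "fps_conv_radius g \<ge> 1"
proof -
  show "fps_conv_radius h \<ge> 1"
    by (rule fps_conv_radius_ge_1, rule order_trans[OF coeff_boundsD(5)[OF assms]]) auto
  show "fps_conv_radius g \<ge> 1"
    by (rule fps_conv_radius_ge_1, rule order_trans[OF coeff_boundsD(6)[OF assms]]) auto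
qed

text \<open>
  This is $-i\,\partial f/\partial\theta$ at $z = r e^{i\theta}$ for $f = h + \overline g$. Without
  the factor $i$ its series has the same shape as that of $f$.
\<close>

definition rotational_deriv :: "complex fps \<Rightarrow> complex fps \<Rightarrow> complex \<Rightarrow> complex" where
  "rotational_deriv h g z = z * eval_fps (fps_deriv h) z - cnj (z * eval_fps (fps_deriv g) z)"

lemma sums_times_eval_fps_deriv:
  fixes a :: "complex fps"
  assumes "ereal (cmod z) < fps_conv_radius a"
  shows "(\<lambda>n. of_nat n * (fps_nth a n * z ^ n)) sums (z * eval_fps (fps_deriv a) z)"
proof -
  have "ereal (cmod z) < fps_conv_radius (fps_deriv a)"
    using assms fps_conv_radius_deriv[of a] by (rule less_le_trans)
  from sums_mult[OF sums_eval_fps[OF this], of z]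
  have "(\<lambda>n. of_nat (Suc n) * (fps_nth a (Suc n) * z ^ Suc n)) sums (z * eval_fps (fps_deriv a) z)"
    by (simp add: mult_ac)
  from sums_Suc[OF this] show ?thesis by simp
qed

context
  fixes h g :: "complex fps"
  assumes cb: "coeff_bounds h g"
begin

lemma conv_radius_gt:
  assumes "cmod z < 1"
  shows "ereal (cmod z) < fps_conv_radius h" "ereal (cmod z) < fps_conv_radius g"
  using less_le_trans[of "ereal (cmod z)" 1] conv_radius_coeff_bounds[OF cb] assms by auto

lemma subset_eball_coeff_bounds:
  assumes "A \<subseteq> ball 0 1"
  shows "A \<subseteq> eball 0 (fps_conv_radius h)" "A \<subseteq> eball 0 (fps_conv_radius g)"
  using conv_radius_coeff_bounds[OF cb]
  by (intro order_trans[OF assms ball_eball_mono]; simp add: one_ereal_def)+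

lemma sums_harmonic_map:
  assumes "cmod z < 1"
  shows "(\<lambda>n. fps_nth h n * z ^ n + cnj (fps_nth g n * z ^ n)) sums harmonic_map h g z"
  unfolding harmonic_map_def
  by (intro sums_add sums_eval_fps conv_radius_gt assms iffD2[OF sums_cnj])

lemma sums_rotational_deriv:
  assumes "cmod z < 1"
  shows "(\<lambda>n. of_nat n * (fps_nth h n * z ^ n - cnj (fps_nth g n * z ^ n)))
    sums rotational_deriv h g z"
proof -
  have "(\<lambda>n. of_nat n * (fps_nth h n * z ^ n) - cnj (of_nat n * (fps_nth g n * z ^ n)))
    sums rotational_deriv h g z"
    unfolding rotational_deriv_def
    by (intro sums_diff sums_times_eval_fps_deriv conv_radius_gt assms iffD2[OF sums_cnj])
  then show ?thesis by (simp add: right_diff_distrib)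
qed

text \<open>
  For real $k$, the term of index $n$ in $A + k f$ is $(n+k) a_n z^n - \overline{(n-k) b_n z^n}$.
  It has the form bounded here, with $p = n + k$ and $q = n - k$, if $|k| \le n$.
\<close>

lemma norm_coeff_combination_le:
  fixes p q r :: real
  assumes n: "n \<ge> 2" and "0 \<le> p" "0 \<le> q" and z: "cmod z = r"
  shows "cmod (of_real p * (fps_nth h n * z ^ n) - of_real q * cnj (fps_nth g n * z ^ n))
    \<le> (p * ((real n + 1) / 2) + q * ((real n - 1) / 2)) * r ^ n"
proof -
  have "cmod (of_real p * (fps_nth h n * z ^ n) - of_real q * cnj (fps_nth g n * z ^ n))
    \<le> cmod (of_real p * (fps_nth h n * z ^ n)) + cmod (of_real q * cnj (fps_nth g n * z ^ n))"
    by (rule norm_triangle_ineq4)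
  also have "\<dots> = p * cmod (fps_nth h n) * r ^ n + q * cmod (fps_nth g n) * r ^ n"
    using assms by (simp add: norm_mult norm_power)
  also have "\<dots> \<le> p * ((real n + 1) / 2) * r ^ n + q * ((real n - 1) / 2) * r ^ n"
    using assms coeff_boundsD(5,6)[OF cb, of n]
    by (intro add_mono mult_right_mono mult_left_mono) auto
  finally show ?thesis by (simp add: algebra_simps)
qed

section \<open>Distance from the identity, univalence\<close>

text \<open>
  Since $|z^n - w^n| \le n r^{n-1} |z - w|$ and $|a_n| + |b_n| \le n$, the term of index $n$ in
  $f(z) - f(w)$ is at most $n^2 r^{n-1} |z - w|$.
\<close>

lemma harmonic_map_near_identity:
  assumes "0 < r" "r < 1" "cmod z \<le> r" "cmod w \<le> r"
  shows "cmod (harmonic_map h g z - harmonic_map h g w - (z - w))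
    \<le> cmod (z - w) / r * (r * (1 + r) / (1 - r) ^ 3 - r)"
proof -
  let ?F = "\<lambda>n. fps_nth h n * z ^ n + cnj (fps_nth g n * z ^ n)
    - (fps_nth h n * w ^ n + cnj (fps_nth g n * w ^ n))"
  have "?F sums (harmonic_map h g z - harmonic_map h g w)"
    using assms by (intro sums_diff sums_harmonic_map) auto
  moreover have "cmod (?F n) \<le> cmod (z - w) / r * ((real n ^ 2 + 0) * r ^ n)" if n: "n \<ge> 2" for n
  proof -
    have pw: "cmod (z ^ n - w ^ n) \<le> real n * r ^ (n - 1) * cmod (z - w)"
    proof -
      have "cmod (\<Sum>i<n. w ^ (n - Suc i) * z ^ i) \<le> (\<Sum>i<n. r ^ (n - Suc i) * r ^ i)"
        by (intro sum_norm_le) (auto simp: norm_mult norm_power intro!: mult_mono power_mono assms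
            zero_le_power order.strict_implies_order[OF assms(1)])
      also have "\<dots> = (\<Sum>i<n. r ^ (n - 1))"
        by (intro sum.cong refl) (auto simp flip: power_add)
      finally show ?thesis
        by (simp add: power_diff_sumr2 norm_mult mult.commute mult_left_mono)
    qed
    have "?F n = fps_nth h n * (z ^ n - w ^ n) + cnj (fps_nth g n * (z ^ n - w ^ n))"
      by (simp add: algebra_simps)
    also have "cmod \<dots> \<le> cmod (fps_nth h n) * cmod (z ^ n - w ^ n)
        + cmod (fps_nth g n) * cmod (z ^ n - w ^ n)"
      by (rule order_trans[OF norm_triangle_ineq]) (simp only: complex_mod_cnj norm_mult)
    also have "\<dots> \<le> (real n + 1) / 2 * cmod (z ^ n - w ^ n) + (real n - 1) / 2 * cmod (z ^ n - w ^ n)"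
      using n coeff_boundsD(5,6)[OF cb, of n] by (intro add_mono mult_right_mono) auto
    also have "\<dots> = real n * cmod (z ^ n - w ^ n)" by (simp add: field_simps)
    also have "\<dots> \<le> real n * (real n * r ^ (n - 1) * cmod (z - w))"
      by (intro mult_left_mono pw) auto
    also have "\<dots> = cmod (z - w) / r * ((real n ^ 2 + 0) * r ^ n)"
      using n assms by (cases n) (auto simp: power2_eq_square)
    finally show ?thesis .
  qed
  ultimately have "cmod (harmonic_map h g z - harmonic_map h g w - ?F 1)
      \<le> cmod (z - w) / r * (r * (1 + r) / (1 - r) ^ 3 + 0 * r / (1 - r) - (1 + 0) * r)"
    using assms by (intro norm_series_tail_le) (auto simp: coeff_boundsD[OF cb])
  then show ?thesis using coeff_boundsD[OF cb] by simp
qed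

lemma harmonic_map_0: "harmonic_map h g 0 = 0"
  by (simp add: harmonic_map_def eval_fps_at_0 coeff_boundsD[OF cb])

lemma harmonic_map_near_identity_strict:
  assumes \<alpha>: "0 \<le> \<alpha>" "\<alpha> < 1" and "cmod z < rS \<alpha>" "cmod w < rS \<alpha>" "z \<noteq> w"
  shows "cmod (harmonic_map h g z - harmonic_map h g w - (z - w)) < cmod (z - w)"
proof -
  define r where "r = max (cmod z) (cmod w)"
  have "z \<noteq> 0 \<or> w \<noteq> 0" using assms by auto
  then have r: "0 < r" "r < rS \<alpha>" "cmod z \<le> r" "cmod w \<le> r"
    using assms by (auto simp: r_def less_max_iff_disj)
  have r1: "r < 1" using r is_rS_rS[OF \<alpha>] by (auto simp: is_rS_iff)
  have "r * (1 + r) / (1 - r) ^ 3 - r < r"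
    using coefficient_majorant_less(2)[OF \<alpha> r(1,2)] by simp
  then have "cmod (z - w) / r * (r * (1 + r) / (1 - r) ^ 3 - r) < cmod (z - w) / r * r"
    using assms r by (intro mult_strict_left_mono) auto
  with harmonic_map_near_identity[OF r(1) r1 r(3,4)] r show ?thesis by simp
qed

lemma inj_on_harmonic_map:
  assumes \<alpha>: "0 \<le> \<alpha>" "\<alpha> < 1"
  shows "inj_on (harmonic_map h g) (ball 0 (rS \<alpha>))"
proof (rule inj_onI, rule ccontr)
  fix z w assume "z \<in> ball 0 (rS \<alpha>)" "w \<in> ball 0 (rS \<alpha>)"
    and eq: "harmonic_map h g z = harmonic_map h g w" and ne: "z \<noteq> w"
  then show False
    using harmonic_map_near_identity_strict[OF \<alpha>, of z w] by (simp add: norm_minus_commute)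
qed

text \<open>
  The case $w = 0$ of \<open>harmonic_map_near_identity_strict\<close> reads $|f(z)/z - 1| < 1$.
\<close>

lemma Re_harmonic_map_quotient_pos:
  assumes \<alpha>: "0 \<le> \<alpha>" "\<alpha> < 1" and "cmod z < rS \<alpha>" "z \<noteq> 0"
  shows "0 < Re (harmonic_map h g z / z)"
proof -
  have "cmod (harmonic_map h g z / z - 1) = cmod (harmonic_map h g z - z) / cmod z"
    using assms by (simp add: diff_divide_distrib flip: norm_divide)
  also have "\<dots> < 1"
    using harmonic_map_near_identity_strict[OF \<alpha>, of z 0] assms le_less_trans[OF norm_ge_zero assms(3)]
    by (auto simp: harmonic_map_0)
  finally show ?thesis
    using abs_Re_le_cmod[of "harmonic_map h g z / z - 1"] by simp
qed

section \<open>The derivative of the argument along circles\<close>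

text \<open>
  For $k > 0$, a number $u/B$ has positive real part if and only if $|u - kB| < |u + kB|$. This is
  applied to $u = A - \alpha B$ with $k = 1 - \alpha$, the choice for which $u - kB = A - B$ has no
  term of index $1$. In the term of index $n$ the bounds for the two sides add up to
  $2(n^2 - \alpha) r^n$, because the factors $n - 1$ and $n + 1 - 2\alpha$ at $|a_n|$ add up to
  $2(n - \alpha)$, and $n + 1$ and $n - 1 + 2\alpha$ at $|b_n|$ to $2(n + \alpha)$. So the majorant
  in the definition of the radius is reached without loss; estimating $A - B$ against $B$ alone
  would give a smaller radius.
\<close>

lemma Re_rotational_deriv_quotient_gt:
  assumes \<alpha>: "0 \<le> \<alpha>" "\<alpha> < 1" and "cmod z < rS \<alpha>" "z \<noteq> 0"
  shows "\<alpha> < Re (rotational_deriv h g z / harmonic_map h g z)"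
proof -
  define r where "r = cmod z"
  define A where "A = rotational_deriv h g z"
  define B where "B = harmonic_map h g z"
  have r: "0 < r" "r < rS \<alpha>" "r < 1"
    using assms is_rS_rS[OF \<alpha>] by (auto simp: r_def is_rS_iff)
  have B0: "B \<noteq> 0"
    using Re_harmonic_map_quotient_pos[OF assms] by (auto simp: B_def)
  let ?M = "r * (1 + r) / (1 - r) ^ 3"
  let ?H = "\<lambda>n. fps_nth h n * z ^ n" and ?G = "\<lambda>n. cnj (fps_nth g n * z ^ n)"
  let ?A = "\<lambda>n. of_nat n * (?H n - ?G n)" and ?B = "\<lambda>n. ?H n + ?G n"
  have A: "?A sums A" and B: "?B sums B"
    unfolding A_def B_def using r
    by (auto simp only: r_def intro!: sums_rotational_deriv sums_harmonic_map)
  have "cmod (A - B - (?A 1 - ?B 1)) \<le> 1 * (?M + (-1) * r / (1 - r) - (1 + (-1)) * r)"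
  proof (rule norm_series_tail_le[where F = "\<lambda>n. ?A n - ?B n"])
    show "(\<lambda>n. ?A n - ?B n) sums (A - B)" by (intro sums_diff A B)
    fix n :: nat assume n: "n \<ge> 2"
    have "?A n - ?B n = of_real (real n - 1) * ?H n - of_real (real n + 1) * ?G n"
      by (simp add: algebra_simps)
    then have "cmod (?A n - ?B n)
        \<le> ((real n - 1) * ((real n + 1) / 2) + (real n + 1) * ((real n - 1) / 2)) * r ^ n"
      using norm_coeff_combination_le[OF n, of "real n - 1" "real n + 1" z r] n
      by (simp add: r_def)
    also have "\<dots> = 1 * ((real n ^ 2 + -1) * r ^ n)"
      by (simp add: power2_eq_square field_simps)
    finally show "cmod (?A n - ?B n) \<le> 1 * ((real n ^ 2 + -1) * r ^ n)" .
  qed (use r coeff_boundsD[OF cb] in auto)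
  then have minus: "cmod (A - B) \<le> ?M - r / (1 - r)"
    using coeff_boundsD[OF cb] by simp
  let ?k = "1 - 2 * \<alpha>"
  let ?C = "\<lambda>n. ?A n + of_real ?k * ?B n"
  have tail: "cmod (A + of_real ?k * B - ?C 1) \<le> 1 * (?M + ?k * r / (1 - r) - (1 + ?k) * r)"
  proof (rule norm_series_tail_le[where F = ?C])
    show "?C sums (A + of_real ?k * B)" by (intro sums_add sums_mult A B)
    fix n :: nat assume n: "n \<ge> 2"
    have "?C n = of_real (real n + ?k) * ?H n - of_real (real n - ?k) * ?G n"
      by (simp add: algebra_simps)
    then have "cmod (?C n)
        \<le> ((real n + ?k) * ((real n + 1) / 2) + (real n - ?k) * ((real n - 1) / 2)) * r ^ n"
      using norm_coeff_combination_le[OF n, of "real n + ?k" "real n - ?k" z r] n \<alpha>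
      by (simp add: r_def)
    also have "\<dots> = 1 * ((real n ^ 2 + ?k) * r ^ n)"
      by (simp add: power2_eq_square field_simps)
    finally show "cmod (?C n) \<le> 1 * ((real n ^ 2 + ?k) * r ^ n)" .
  qed (use r coeff_boundsD[OF cb] in auto)
  have C1: "?C 1 = of_real (2 * (1 - \<alpha>)) * z"
    using coeff_boundsD[OF cb] by (simp add: algebra_simps)
  have "cmod (of_real (2 * (1 - \<alpha>)) * z) = 2 * (1 - \<alpha>) * r"
    using \<alpha> by (simp add: norm_mult r_def del: of_real_mult of_real_diff)
  moreover have "1 + ?k = 2 * (1 - \<alpha>)" by simp
  ultimately have plus: "2 * (1 - \<alpha>) * r - (?M + ?k * r / (1 - r) - 2 * (1 - \<alpha>) * r)
      \<le> cmod (A + of_real ?k * B)"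
    using tail[unfolded C1 mult_1] norm_triangle_ineq2[of "of_real (2 * (1 - \<alpha>)) * z" "A + of_real ?k * B"]
    by (simp only: norm_minus_commute[of "of_real (2 * (1 - \<alpha>)) * z"])
  have "?k * r / (1 - r) = r / (1 - r) - 2 * (\<alpha> * r / (1 - r))"
    by (simp add: diff_divide_distrib left_diff_distrib)
  with minus plus coefficient_majorant_less(1)[OF \<alpha> r(1,2)]
  have "cmod (A - B) < cmod (A + of_real ?k * B)" by linarith
  then have "cmod (A - B) ^ 2 < cmod (A + of_real ?k * B) ^ 2"
    by (intro power_strict_mono) auto
  \<comment> \<open>Polarization turns the comparison of moduli into the sign of a real part.\<close>
  moreover define X where "X = Re ((A - of_real \<alpha> * B) * cnj B)"
  have "cmod (A + of_real ?k * B) ^ 2 = cmod (A - B) ^ 2 + 4 * (1 - \<alpha>) * X"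
    unfolding cmod_power2 X_def by (simp add: power2_eq_square algebra_simps)
  ultimately have "0 < 4 * (1 - \<alpha>) * X" by simp
  then have "0 < X" using \<alpha> by (simp add: zero_less_mult_iff)
  then have "0 < Re ((A - of_real \<alpha> * B) * cnj B)" unfolding X_def .
  then have "0 < Re ((A - of_real \<alpha> * B) / B)"
    using B0 by (simp add: complex_div_cnj[of _ B] Re_divide_of_real zero_less_divide_iff
        flip: of_real_power)
  also have "(A - of_real \<alpha> * B) / B = A / B - of_real \<alpha>"
    using B0 by (simp add: diff_divide_distrib)
  finally show ?thesis by (simp add: A_def B_def)
qed

lemma has_field_derivative_coeff_bounds:
  assumes "cmod z < 1"
  shows "(eval_fps h has_field_derivative eval_fps (fps_deriv h) z) (at z)"
    and "(eval_fps g has_field_derivative eval_fps (fps_deriv g) z) (at z)"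
  by (intro has_field_derivative_eval_fps conv_radius_gt assms)+

lemma continuous_on_harmonic_map:
  assumes "A \<subseteq> ball 0 1"
  shows "continuous_on A (harmonic_map h g)"
proof -
  have "continuous_on A (eval_fps h)" "continuous_on A (eval_fps g)"
    by (intro holomorphic_on_imp_continuous_on holomorphic_on_eval_fps
        subset_eball_coeff_bounds assms)+
  then show ?thesis
    unfolding harmonic_map_def by (intro continuous_on_add continuous_on_cnj)
qed

lemma rcis_has_vector_derivative:
  "((\<lambda>\<theta>. rcis r \<theta>) has_vector_derivative \<i> * rcis r \<theta>) (at \<theta>)"
  unfolding has_vector_derivative_complex_iff
  by (auto intro!: derivative_eq_intros)

lemma harmonic_map_circle_derivative:
  assumes "0 < r" "r < 1"
  shows "((\<lambda>\<theta>. harmonic_map h g (rcis r \<theta>)) has_vector_derivative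
    \<i> * rotational_deriv h g (rcis r \<theta>)) (at \<theta>)"
proof -
  have z: "cmod (rcis r \<theta>) < 1" using assms by simp
  let ?z = "rcis r \<theta>"
  have "((eval_fps h \<circ> rcis r) has_vector_derivative \<i> * ?z * eval_fps (fps_deriv h) ?z) (at \<theta>)"
    by (rule field_vector_diff_chain_at[OF rcis_has_vector_derivative
          has_field_derivative_coeff_bounds(1)[OF z]])
  moreover have "((eval_fps g \<circ> rcis r) has_vector_derivative \<i> * ?z * eval_fps (fps_deriv g) ?z) (at \<theta>)"
    by (rule field_vector_diff_chain_at[OF rcis_has_vector_derivative
          has_field_derivative_coeff_bounds(2)[OF z]])
  ultimately have "((\<lambda>\<theta>. eval_fps h (rcis r \<theta>) + cnj (eval_fps g (rcis r \<theta>))) has_vector_derivative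
      \<i> * ?z * eval_fps (fps_deriv h) ?z + cnj (\<i> * ?z * eval_fps (fps_deriv g) ?z)) (at \<theta>)"
    by (intro has_vector_derivative_add has_vector_derivative_cnj) (simp_all add: o_def)
  moreover have "\<i> * ?z * eval_fps (fps_deriv h) ?z + cnj (\<i> * ?z * eval_fps (fps_deriv g) ?z)
      = \<i> * rotational_deriv h g ?z"
    by (simp add: rotational_deriv_def algebra_simps)
  ultimately show ?thesis unfolding harmonic_map_def by simp
qed

text \<open>
  A branch of $\arg f$ on the circle. The quotient $f(z)/z$ stays in the right half-plane, so the
  principal logarithm is smooth along the whole curve and has no monodromy. The winding number
  $1$ is thus built into the definition, as \<open>arg_branch_periodic\<close> shows.
\<close>

definition arg_branch :: "real \<Rightarrow> real \<Rightarrow> real" where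
  "arg_branch r \<theta> = \<theta> + Im (Ln (harmonic_map h g (rcis r \<theta>) / rcis r \<theta>))"

lemma arg_branch_periodic: "arg_branch r (\<theta> + 2 * pi) = arg_branch r \<theta> + 2 * pi"
proof -
  have "rcis r (\<theta> + 2 * pi) = rcis r \<theta>" by (simp add: rcis_def flip: cis_mult)
  then show ?thesis by (simp add: arg_branch_def)
qed

lemma harmonic_map_circle_ne_0:
  assumes "0 \<le> \<alpha>" "\<alpha> < 1" "0 < r" "r < rS \<alpha>"
  shows "harmonic_map h g (rcis r \<theta>) \<noteq> 0"
  using Re_harmonic_map_quotient_pos[of \<alpha> "rcis r \<theta>"] assms by auto

lemma harmonic_map_eq_rcis_arg_branch:
  assumes "0 \<le> \<alpha>" "\<alpha> < 1" "0 < r" "r < rS \<alpha>"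
  shows "harmonic_map h g (rcis r \<theta>) = rcis (cmod (harmonic_map h g (rcis r \<theta>))) (arg_branch r \<theta>)"
proof -
  let ?z = "rcis r \<theta>" and ?w = "harmonic_map h g (rcis r \<theta>)"
  have ne: "?w / ?z \<noteq> 0" using harmonic_map_circle_ne_0[OF assms] assms by simp
  have "?w / ?z = exp (Ln (?w / ?z))" using ne by simp
  also have "\<dots> = rcis (cmod (?w / ?z)) (Im (Ln (?w / ?z)))"
    using ne by (simp add: exp_eq_polar rcis_def norm_exp_eq_Re[symmetric] del: norm_divide)
  finally have "?w = rcis (cmod (?w / ?z)) (Im (Ln (?w / ?z))) * ?z"
    using assms by (simp add: field_simps)
  also have "\<dots> = rcis (cmod (?w / ?z) * r) (arg_branch r \<theta>)"
    by (simp add: rcis_mult arg_branch_def add.commute)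
  also have "cmod (?w / ?z) * r = cmod ?w" using assms by (simp add: norm_divide)
  finally show ?thesis .
qed

lemma arg_branch_has_derivative:
  assumes \<alpha>: "0 \<le> \<alpha>" "\<alpha> < 1" and r: "0 < r" "r < rS \<alpha>"
  shows "(arg_branch r has_real_derivative
    Re (rotational_deriv h g (rcis r \<theta>) / harmonic_map h g (rcis r \<theta>))) (at \<theta>)"
proof -
  let ?A = "rotational_deriv h g (rcis r \<theta>)" and ?B = "\<lambda>\<theta>. harmonic_map h g (rcis r \<theta>)"
  let ?u = "\<lambda>\<theta>. rcis (1 / r) (- \<theta>)"
  have r1: "r < 1" using r is_rS_rS[OF \<alpha>] by (auto simp: is_rS_iff)
  have quot: "?B \<theta> / rcis r \<theta> = ?B \<theta> * ?u \<theta>" for \<theta>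
    by (simp add: divide_inverse rcis_inverse)
  have u: "(?u has_vector_derivative - \<i> * ?u \<theta>) (at \<theta>)"
    unfolding has_vector_derivative_complex_iff
    using r by (auto intro!: derivative_eq_intros)
  have "((\<lambda>\<theta>. ?B \<theta> * ?u \<theta>) has_vector_derivative
      (?B \<theta> * (- \<i> * ?u \<theta>) + \<i> * ?A * ?u \<theta>)) (at \<theta>)"
    by (rule has_vector_derivative_mult[OF harmonic_map_circle_derivative[OF r(1) r1] u])
  moreover have "?B \<theta> * ?u \<theta> \<notin> \<real>\<^sub>\<le>\<^sub>0"
    using Re_harmonic_map_quotient_pos[OF \<alpha>, of "rcis r \<theta>"] r
    by (auto simp: complex_nonpos_Reals_iff simp flip: quot)
  ultimately have "((Ln \<circ> (\<lambda>\<theta>. ?B \<theta> * ?u \<theta>)) has_vector_derivative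
      (?B \<theta> * (- \<i> * ?u \<theta>) + \<i> * ?A * ?u \<theta>) * inverse (?B \<theta> * ?u \<theta>)) (at \<theta>)"
    by (intro field_vector_diff_chain_at has_field_derivative_Ln)
  also have "(?B \<theta> * (- \<i> * ?u \<theta>) + \<i> * ?A * ?u \<theta>) * inverse (?B \<theta> * ?u \<theta>) = \<i> * (?A / ?B \<theta> - 1)"
    using harmonic_map_circle_ne_0[OF assms, of \<theta>] r by (simp add: field_simps)
  finally have "((\<lambda>\<theta>. Im (Ln (?B \<theta> * ?u \<theta>))) has_real_derivative Re (?A / ?B \<theta>) - 1) (at \<theta>)"
    by (simp add: has_vector_derivative_complex_iff o_def)
  then have "((\<lambda>\<theta>. \<theta> + Im (Ln (?B \<theta> * ?u \<theta>))) has_real_derivative 1 + (Re (?A / ?B \<theta>) - 1)) (at \<theta>)"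
    by (intro DERIV_add DERIV_ident)
  then show ?thesis by (simp add: arg_branch_def[abs_def] quot)
qed

lemma arg_branch_derivative_gt:
  assumes "0 \<le> \<alpha>" "\<alpha> < 1" "0 < r" "r < rS \<alpha>"
  shows "\<alpha> < Re (rotational_deriv h g (rcis r \<theta>) / harmonic_map h g (rcis r \<theta>))"
  using assms by (intro Re_rotational_deriv_quotient_gt) auto

lemma arg_branch_strict_mono:
  assumes "0 \<le> \<alpha>" "\<alpha> < 1" "0 < r" "r < rS \<alpha>" "s < t"
  shows "arg_branch r s < arg_branch r t"
proof (rule DERIV_pos_imp_increasing[OF \<open>s < t\<close>])
  fix x
  show "\<exists>y. DERIV (arg_branch r) x :> y \<and> 0 < y"
    using arg_branch_has_derivative[OF assms(1-4)] arg_branch_derivative_gt[OF assms(1-4)]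
      le_less_trans[OF assms(1)] by blast
qed

text \<open>
  If two points of the circle have images on one ray, their values of the branch differ by a
  multiple of $2\pi$. Choosing their arguments less than one turn apart makes this difference
  smaller than $2\pi$, hence zero, and the branch is strictly monotone.
\<close>

lemma circle_image_meets_ray_once:
  assumes \<alpha>: "0 \<le> \<alpha>" "\<alpha> < 1" and r: "0 < r" "r < rS \<alpha>"
    and z: "cmod z = r" and w: "cmod w = r"
    and ray: "harmonic_map h g z = of_real c * harmonic_map h g w" and c: "0 < c"
  shows "z = w"
proof -
  note hyps = \<alpha> r
  have aux: "s = t"
    if eq: "cis (arg_branch r s) = cis (arg_branch r t)" and "s \<le> t" "t < s + 2 * pi" for s t
  proof (rule ccontr)
    assume "s \<noteq> t"
    then have "arg_branch r s < arg_branch r t" "arg_branch r t < arg_branch r s + 2 * pi"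
      using that arg_branch_strict_mono[OF hyps, of s t]
        arg_branch_strict_mono[OF hyps, of t "s + 2 * pi"] by (auto simp: arg_branch_periodic)
    moreover obtain k :: int where k: "arg_branch r t = arg_branch r s + 2 * pi * k"
      using arg_cong[OF eq, of Re] arg_cong[OF eq, of Im]
        sin_cos_eq_iff[of "arg_branch r t" "arg_branch r s"]
      by auto
    ultimately have "0 < 2 * pi * k" "2 * pi * k < 2 * pi * 1" by auto
    then have "0 < k" "k < 1" by (simp_all add: zero_less_mult_iff)
    then show False by simp
  qed
  have zw: "rcis r (Arg z) = z" "rcis r (Arg w) = w" 
    using z w rcis_cmod_Arg[of z] rcis_cmod_Arg[of w] by simp_all
  have "cis (arg_branch r (Arg z)) = cis (arg_branch r (Arg w))"
  proof -
    let ?Z = "harmonic_map h g z" and ?W = "harmonic_map h g w"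
    have Z: "?Z = rcis (cmod ?Z) (arg_branch r (Arg z))"
      using harmonic_map_eq_rcis_arg_branch[OF hyps, of "Arg z"] by (simp add: zw)
    have W: "?W = rcis (cmod ?W) (arg_branch r (Arg w))"
      using harmonic_map_eq_rcis_arg_branch[OF hyps, of "Arg w"] by (simp add: zw)
    have W0: "?W \<noteq> 0" using harmonic_map_circle_ne_0[OF hyps, of "Arg w"] by (simp add: zw)
    have "cmod ?Z = c * cmod ?W" using ray c by (simp add: norm_mult)
    with Z have "?Z = of_real c * of_real (cmod ?W) * cis (arg_branch r (Arg z))"
      by (simp add: rcis_def)
    moreover have "?Z = of_real c * of_real (cmod ?W) * cis (arg_branch r (Arg w))"
      using ray W by (metis mult.assoc rcis_def)
    ultimately show ?thesis using c W0 by simp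
  qed
  then have "Arg z = Arg w"
    using aux[of "Arg z" "Arg w"] aux[of "Arg w" "Arg z"] Arg_bounded[of z] Arg_bounded[of w]
    by (cases "Arg z \<le> Arg w") auto
  then show ?thesis using zw by metis
qed

end

section \<open>From rays to starlike domains\<close>

text \<open>
  The image $D$ of the open disk is the required domain. Suppose that $w \in D$ but the segment
  from $0$ to $w$ leaves $D$. Then this segment contains a frontier point, and the ray beyond $w$
  contains another one, since $D$ is bounded. Both lie on the image of the circle and on the same
  ray, so they coincide, although $w$ lies strictly between them.
\<close>

lemma bounds_starlike_domain_image:
  assumes r: "0 < r" and cont: "continuous_on (cball 0 r) f" and inj: "inj_on f (cball 0 r)"
    and f0: "f 0 = 0"
    and ray: "\<And>z w c. cmod z = r \<Longrightarrow> cmod w = r \<Longrightarrow> 0 < c \<Longrightarrow>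
      f z = of_real c * f w \<Longrightarrow> z = w"
  shows "bounds_starlike_domain (f ` sphere 0 r)"
proof -
  let ?D = "f ` ball 0 r"
  have sub: "ball (0::complex) r \<subseteq> cball 0 r" by (rule ball_subset_cball)
  have cont': "continuous_on (ball 0 r) f" by (rule continuous_on_subset[OF cont sub])
  have "open ?D"
    by (rule invariance_of_domain[OF cont' open_ball inj_on_subset[OF inj sub]])
  have comp: "compact (f ` cball 0 r)" by (rule compact_continuous_image[OF cont compact_cball])
  have bdd: "bounded ?D" by (rule bounded_subset[OF compact_imp_bounded[OF comp]]) auto
  have "closure ?D = f ` cball 0 r"
  proof
    show "closure ?D \<subseteq> f ` cball 0 r"
      by (intro closure_minimal image_mono sub compact_imp_closed comp)
    show "f ` cball 0 r \<subseteq> closure ?D"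
      using image_closure_subset[of "ball 0 r" f "closure ?D"] cont r
      by (simp add: closure_subset)
  qed
  then have "frontier ?D = f ` cball 0 r - ?D"
    using \<open>open ?D\<close> by (simp add: frontier_def interior_open)
  also have "\<dots> = f ` (cball 0 r - ball 0 r)"
    by (rule inj_on_image_set_diff[OF inj, symmetric]) auto
  finally have front: "frontier ?D = f ` sphere 0 r" by (simp add: cball_diff_eq_sphere)
  have "0 \<in> ?D" using f0 r by (metis centre_in_ball imageI)
  have nz: "f z \<noteq> 0" if "cmod z = r" for z
    using inj_onD[OF inj, of z 0] that r f0 by auto
  have "closed_segment 0 w \<subseteq> ?D" if w: "w \<in> ?D" for w
  proof (rule ccontr)
    assume out: "\<not> closed_segment 0 w \<subseteq> ?D"
    then have "w \<noteq> 0" using w by auto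
    have "closed_segment 0 w \<inter> frontier ?D \<noteq> {}"
      by (rule connected_Int_frontier) (use out w in auto)
    then obtain p where p: "p \<in> closed_segment 0 w" "p \<in> f ` sphere 0 r"
      unfolding front by blast
    obtain z where z: "cmod z = r" "p = f z" using p(2) by auto
    obtain s where s: "0 \<le> s" "s \<le> 1" "f z = of_real s * w"
      using p(1) unfolding z(2) by (auto simp: in_segment scaleR_conv_of_real)
    have "s > 0" using nz[OF z(1)] s by (cases "s = 0") auto
    have "w \<in> interior ?D" using w \<open>open ?D\<close> by (simp add: interior_open)
    from ray_to_frontier[OF bdd this \<open>w \<noteq> 0\<close>]
    obtain d where d: "0 < d" "w + d *\<^sub>R w \<in> frontier ?D" by metis
    then obtain z' where z': "cmod z' = r" "f z' = of_real (1 + d) * w"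
      unfolding front by (auto simp: scaleR_conv_of_real algebra_simps)
    have scaled: "f z = of_real (s / (1 + d)) * f z'"
      using s z' d by (simp del: of_real_add)
    have "z = z'" by (rule ray[OF z(1) z'(1) _ scaled]) (use \<open>s > 0\<close> d in simp)
    then have "s = 1 + d" using s z' \<open>w \<noteq> 0\<close> by (simp del: of_real_add)
    then show False using s d by simp
  qed
  then show ?thesis
    unfolding bounds_starlike_domain_def
    using \<open>open ?D\<close> \<open>0 \<in> ?D\<close> bdd front connected_continuous_image[OF cont' connected_ball]
    by blast
qed

section \<open>Harmonicity\<close>

lemma has_derivative_holomorphic_plus_cnj:
  assumes "(p has_field_derivative p') (at z)" "(q has_field_derivative q') (at z)"
  shows "((\<lambda>z. p z + cnj (q z)) has_derivative
    (\<lambda>w. Re w *\<^sub>R (p' + cnj q') + Im w *\<^sub>R (\<i> * p' + cnj (\<i> * q')))) (at z)"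
proof -
  have "((\<lambda>z. p z + cnj (q z)) has_derivative (\<lambda>w. p' * w + cnj (q' * w))) (at z)"
    using assms unfolding has_field_derivative_def
    by (intro has_derivative_add bounded_linear.has_derivative[OF bounded_linear_cnj])
  moreover have "p' * w + cnj (q' * w)
      = Re w *\<^sub>R (p' + cnj q') + Im w *\<^sub>R (\<i> * p' + cnj (\<i> * q'))" for w
    by (simp add: complex_eq_iff algebra_simps)
  ultimately show ?thesis by simp
qed

lemma harmonic_on_holomorphic_plus_cnj:
  assumes "open S" and p: "p holomorphic_on S" and q: "q holomorphic_on S"
  shows "harmonic_on (\<lambda>z. p z + cnj (q z)) S"
proof -
  have D: "(p has_field_derivative deriv p z) (at z)" "(q has_field_derivative deriv q z) (at z)"
    "(deriv p has_field_derivative deriv (deriv p) z) (at z)"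
    "(deriv q has_field_derivative deriv (deriv q) z) (at z)" if "z \<in> S" for z
    using that assms by (auto intro!: holomorphic_derivI holomorphic_deriv)
  have [continuous_intros]: "continuous_on S (deriv (deriv p))" "continuous_on S (deriv (deriv q))"
    using assms by (auto intro!: holomorphic_on_imp_continuous_on holomorphic_deriv)
  let ?P = "\<lambda>c z. c * deriv (deriv p) z + cnj (c * deriv (deriv q) z)"
  show ?thesis
    unfolding harmonic_on_def
  proof (intro conjI exI ballI)
    show "continuous_on S (?P 1)" "continuous_on S (?P \<i>)" "continuous_on S (?P \<i>)"
      "continuous_on S (?P (\<i> * \<i>))"
      by (intro continuous_intros)+
    fix z assume z: "z \<in> S"
    show "((\<lambda>z. p z + cnj (q z)) has_derivative
        (\<lambda>w. Re w *\<^sub>R (deriv p z + cnj (deriv q z))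
          + Im w *\<^sub>R (\<i> * deriv p z + cnj (\<i> * deriv q z)))) (at z)"
      by (intro has_derivative_holomorphic_plus_cnj D z)
    show "((\<lambda>z. deriv p z + cnj (deriv q z)) has_derivative
        (\<lambda>w. Re w *\<^sub>R ?P 1 z + Im w *\<^sub>R ?P \<i> z)) (at z)"
      using has_derivative_holomorphic_plus_cnj[OF D(3,4)[OF z]] by simp
    show "((\<lambda>z. \<i> * deriv p z + cnj (\<i> * deriv q z)) has_derivative
        (\<lambda>w. Re w *\<^sub>R ?P \<i> z + Im w *\<^sub>R ?P (\<i> * \<i>) z)) (at z)"
      using has_derivative_holomorphic_plus_cnj[OF DERIV_cmult[OF D(3)[OF z], of \<i>]
          DERIV_cmult[OF D(4)[OF z], of \<i>]] by (simp add: mult.assoc)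
    show "?P 1 z + ?P (\<i> * \<i>) z = 0" by simp
  qed (rule \<open>open S\<close>)
qed

section \<open>Full starlikeness within the radius\<close>

lemma fully_starlike_harmonic_map:
  assumes cb: "coeff_bounds h g" and \<alpha>: "0 \<le> \<alpha>" "\<alpha> < 1"
  shows "fully_starlike \<alpha> (harmonic_map h g) (rS \<alpha>)"
  unfolding fully_starlike_def
proof (intro conjI allI impI)
  have R1: "rS \<alpha> < 1" using is_rS_rS[OF \<alpha>] by (auto simp: is_rS_iff)
  show "harmonic_on (harmonic_map h g) (ball 0 (rS \<alpha>))"
    unfolding harmonic_map_def[abs_def]
    by (intro harmonic_on_holomorphic_plus_cnj open_ball holomorphic_on_eval_fps
        subset_eball_coeff_bounds[OF cb] subset_ball) (use R1 in auto)
  show "harmonic_map h g 0 = 0" by (rule harmonic_map_0[OF cb])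
  fix r assume "0 < r \<and> r < rS \<alpha>"
  then have r: "0 < r" "r < rS \<alpha>" by auto
  have inj: "inj_on (harmonic_map h g) (cball 0 r)"
    by (rule inj_on_subset[OF inj_on_harmonic_map[OF cb \<alpha>]]) (use r in auto)
  then show "inj_on (harmonic_map h g) (sphere 0 r)"
    by (rule inj_on_subset) auto
  show "bounds_starlike_domain (harmonic_map h g ` sphere 0 r)"
  proof (rule bounds_starlike_domain_image[OF r(1) _ inj harmonic_map_0[OF cb]])
    show "continuous_on (cball 0 r) (harmonic_map h g)"
      by (rule continuous_on_harmonic_map[OF cb]) (use r R1 in auto)
  qed (use circle_image_meets_ray_once[OF cb \<alpha> r] in blast)
  show "arg_derivative_greater \<alpha> (harmonic_map h g) r"
    unfolding arg_derivative_greater_def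
    by (intro exI[of _ "arg_branch h g r"]
        exI[of _ "\<lambda>\<theta>. Re (rotational_deriv h g (rcis r \<theta>) / harmonic_map h g (rcis r \<theta>))"]
        conjI allI ballI harmonic_map_circle_ne_0[OF cb \<alpha> r]
        harmonic_map_eq_rcis_arg_branch[OF cb \<alpha> r]
        arg_branch_has_derivative[OF cb \<alpha> r] arg_branch_derivative_gt[OF cb \<alpha> r])
qed

section \<open>Sharpness\<close>

text \<open>
  The signs are chosen such that, at a positive real point, all terms of
  $A - \alpha f = \sum (n-\alpha) a_n r^n - \sum (n+\alpha) b_n r^n$ of index $n \ge 2$ are negative
  and of maximal modulus.
\<close>

definition extremal_h :: "complex fps" where
  "extremal_h = Abs_fps (\<lambda>n. if n = 0 then 0 else if n = 1 then 1 else - ((of_nat n + 1) / 2))"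

definition extremal_g :: "complex fps" where
  "extremal_g = Abs_fps (\<lambda>n. if n = 0 then 0 else (of_nat n - 1) / 2)"

lemma coeff_bounds_extremal: "coeff_bounds extremal_h extremal_g"
  unfolding coeff_bounds_def
proof (intro conjI allI impI)
  fix n :: nat assume n: "n \<ge> 1"
  have 1: "cmod ((of_nat n + 1) / 2) = (real n + 1) / 2" 
    using norm_of_real[of "(real n + 1) / 2", where ?'a = complex] by simp
  have 2: "cmod ((of_nat n - 1) / 2) = (real n - 1) / 2" 
    using n norm_of_real[of "(real n - 1) / 2", where ?'a = complex] by simp
  show "cmod (fps_nth extremal_h n) \<le> (real n + 1) / 2"
    using n 1 by (auto simp: extremal_h_def simp del: norm_divide)
  show "cmod (fps_nth extremal_g n) \<le> (real n - 1) / 2"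
    using n 2 by (auto simp: extremal_g_def simp del: norm_divide)
qed (auto simp: extremal_h_def extremal_g_def)

text \<open>
  On the positive axis the coefficients of $f$ are $1$ at $n = 1$ and $-1$ at $n \ge 2$, and those
  of $A$ are $1$ and $-n^2$. Writing $1 = 2 - 1$ at $n = 1$ leaves $2r$ minus the full series
  $\sum_{n \ge 1} r^n$ here and minus $\sum_{n \ge 1} n^2 r^n$ in the next lemma.
\<close>

lemma harmonic_map_extremal_real:
  assumes "0 < r" "r < 1"
  shows "harmonic_map extremal_h extremal_g (of_real r) = of_real (2 * r - r / (1 - r))"
proof -
  have "(\<lambda>n. (if n = 1 then 2 * r else 0) - (if n = 0 then 0 else r ^ n)) sums (2 * r - r / (1 - r))"
  proof (rule sums_diff)
    show "(\<lambda>n. if n = 1 then 2 * r else 0) sums (2 * r)" by (rule sums_single)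
    have "(\<lambda>n. r * r ^ n) sums (r * (1 / (1 - r)))"
      using assms by (intro sums_mult geometric_sums) auto
    then have "(\<lambda>n. if Suc n = 0 then 0 else r ^ Suc n) sums (r / (1 - r))" by simp
    then show "(\<lambda>n. if n = 0 then 0 else r ^ n) sums (r / (1 - r))"
      by (rule sums_Suc_imp[rotated]) simp
  qed
  from iffD2[OF sums_of_real_iff[where ?'a = complex], OF this]
  have "(\<lambda>n. fps_nth extremal_h n * of_real r ^ n + cnj (fps_nth extremal_g n * of_real r ^ n))
      sums of_real (2 * r - r / (1 - r))"
    by (rule back_subst[where P = "\<lambda>f. f sums _"])
      (auto simp: extremal_h_def extremal_g_def field_simps)
  with sums_harmonic_map[OF coeff_bounds_extremal, of "of_real r"] assms
  show ?thesis by (auto dest: sums_unique2)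
qed

lemma rotational_deriv_extremal_real:
  assumes "0 < r" "r < 1"
  shows "rotational_deriv extremal_h extremal_g (of_real r)
    = of_real (2 * r - r * (1 + r) / (1 - r) ^ 3)"
proof -
  have "(\<lambda>n. (if n = 1 then 2 * r else 0) - (real n ^ 2 + 0) * r ^ n)
      sums (2 * r - (r * (1 + r) / (1 - r) ^ 3 + 0 / (1 - r)))"
  proof (rule sums_diff)
    show "(\<lambda>n. if n = 1 then 2 * r else 0) sums (2 * r)" by (rule sums_single)
  qed (rule sums_squares_geometric, use assms in auto)
  from iffD2[OF sums_of_real_iff[where ?'a = complex], OF this]
  have "(\<lambda>n. of_nat n * (fps_nth extremal_h n * of_real r ^ n
        - cnj (fps_nth extremal_g n * of_real r ^ n)))
      sums of_real (2 * r - (r * (1 + r) / (1 - r) ^ 3 + 0 / (1 - r)))"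
    by (rule back_subst[where P = "\<lambda>f. f sums _"])
      (auto simp: extremal_h_def extremal_g_def field_simps power2_eq_square)
  with sums_rotational_deriv[OF coeff_bounds_extremal, of "of_real r"] assms
  show ?thesis by (auto dest: sums_unique2)
qed

text \<open>
  The derivative of the argument does not depend on the branch. Multiplying the curve by
  $e^{-i\phi}$ makes it real, so the derivative of the product has imaginary part zero; this
  avoids differentiating the modulus.
\<close>

lemma arg_derivative_unique:
  fixes \<gamma> :: "real \<Rightarrow> complex"
  assumes \<gamma>: "(\<gamma> has_vector_derivative \<gamma>') (at t)" "\<gamma> t \<noteq> 0"
    and polar: "\<And>s. \<gamma> s = rcis (cmod (\<gamma> s)) (\<phi> s)"
    and \<phi>: "(\<phi> has_real_derivative \<phi>') (at t)"
  shows "\<phi>' = Im (\<gamma>' / \<gamma> t)"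
proof -
  let ?u = "\<lambda>s. cis (- \<phi> s)"
  have u: "(?u has_vector_derivative - \<i> * of_real \<phi>' * ?u t) (at t)"
    unfolding has_vector_derivative_complex_iff
    using \<phi> by (auto intro!: derivative_eq_intros)
  have real: "\<gamma> s * ?u s = of_real (cmod (\<gamma> s))" for s
    by (subst polar) (simp add: rcis_def mult.assoc cis_mult)
  have "((\<lambda>s. \<gamma> s * ?u s) has_vector_derivative
      (\<gamma> t * (- \<i> * of_real \<phi>' * ?u t) + \<gamma>' * ?u t)) (at t)"
    by (rule has_vector_derivative_mult[OF \<gamma>(1) u])
  then have "((\<lambda>s. Im (\<gamma> s * ?u s)) has_real_derivative
      Im (\<gamma> t * (- \<i> * of_real \<phi>' * ?u t) + \<gamma>' * ?u t)) (at t)"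
    by (simp only: has_vector_derivative_complex_iff)
  then have "((\<lambda>s. 0) has_real_derivative
      Im (\<gamma> t * (- \<i> * of_real \<phi>' * ?u t) + \<gamma>' * ?u t)) (at t)"
    by (simp only: real Im_complex_of_real)
  then have "Im (\<gamma> t * (- \<i> * of_real \<phi>' * ?u t) + \<gamma>' * ?u t) = 0"
    by (rule DERIV_unique) (rule DERIV_const)
  moreover have "\<gamma> t * (- \<i> * of_real \<phi>' * ?u t) + \<gamma>' * ?u t
      = of_real (cmod (\<gamma> t)) * (\<gamma>' / \<gamma> t - \<i> * of_real \<phi>')"
    using \<gamma>(2) by (simp add: field_simps flip: real)
  ultimately have "Im (of_real (cmod (\<gamma> t)) * (\<gamma>' / \<gamma> t - \<i> * of_real \<phi>')) = 0"
    by (simp only:)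
  then show ?thesis using \<gamma>(2) by simp
qed

text \<open>
  The circle of radius $r_S$ itself lies in the larger disk, and at $\theta = 0$ the derivative of
  the argument there is $A/f = \alpha$.
\<close>

lemma not_fully_starlike_extremal:
  assumes \<alpha>: "0 \<le> \<alpha>" "\<alpha> < 1" and \<rho>: "rS \<alpha> < \<rho>"
  shows "\<not> fully_starlike \<alpha> (harmonic_map extremal_h extremal_g) \<rho>"
proof
  let ?f = "harmonic_map extremal_h extremal_g"
  define r where "r = rS \<alpha>"
  have r: "0 < r" "r < 1" "rS_poly \<alpha> r = 0"
    using is_rS_rS[OF \<alpha>] by (auto simp: is_rS_iff r_def)
  assume "fully_starlike \<alpha> ?f \<rho>"
  then have "arg_derivative_greater \<alpha> ?f r"
    using r \<rho> by (simp add: fully_starlike_def r_def)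
  then obtain \<phi> \<phi>' where ne: "\<And>\<theta>. ?f (rcis r \<theta>) \<noteq> 0"
    and polar: "\<And>\<theta>. ?f (rcis r \<theta>) = rcis (cmod (?f (rcis r \<theta>))) (\<phi> \<theta>)"
    and \<phi>: "\<And>\<theta>. (\<phi> has_real_derivative \<phi>' \<theta>) (at \<theta>)"
    and gt: "\<forall>\<theta>\<in>{0..2 * pi}. \<alpha> < \<phi>' \<theta>"
    unfolding arg_derivative_greater_def by metis
  let ?A = "2 * r - r * (1 + r) / (1 - r) ^ 3" and ?B = "2 * r - r / (1 - r)"
  have "\<phi>' 0 = Im (\<i> * rotational_deriv extremal_h extremal_g (rcis r 0) / ?f (rcis r 0))"
    by (rule arg_derivative_unique[OF harmonic_map_circle_derivative[OF coeff_bounds_extremal r(1,2)]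
          ne polar \<phi>])
  also have "\<dots> = ?A / ?B"
    using harmonic_map_extremal_real[OF r(1,2)] rotational_deriv_extremal_real[OF r(1,2)]
    by (simp add: rcis_def flip: of_real_divide del: of_real_diff of_real_mult)
  finally have "\<phi>' 0 = ?A / ?B" .
  moreover have "?A = \<alpha> * ?B"
    using rS_poly_closed_form[OF r(2), of \<alpha>] r(3) by (simp add: algebra_simps)
  moreover have "?B \<noteq> 0"
    using ne[of 0] unfolding rcis_def by (simp add: harmonic_map_extremal_real[OF r(1,2)] del: of_real_diff)
  ultimately have "\<phi>' 0 = \<alpha>" by simp
  then show False using gt by auto
qed

theorem theorem3p5:
  fixes \<alpha> :: real
  assumes "0 \<le> \<alpha>" and "\<alpha> < 1"
  shows "(\<exists>!r. is_rS \<alpha> r) \<and>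
    (\<forall>h g. coeff_bounds h g \<longrightarrow>
       inj_on (harmonic_map h g) (ball 0 (rS \<alpha>)) \<and>
       fully_starlike \<alpha> (harmonic_map h g) (rS \<alpha>)) \<and>
    (\<forall>\<rho>>rS \<alpha>. \<exists>h g. coeff_bounds h g \<and>
       \<not> (inj_on (harmonic_map h g) (ball 0 \<rho>) \<and>
          fully_starlike \<alpha> (harmonic_map h g) \<rho>))"
  using ex1_is_rS[OF assms] inj_on_harmonic_map[OF _ assms] fully_starlike_harmonic_map[OF _ assms]
    coeff_bounds_extremal not_fully_starlike_extremal[OF assms]
  by blast

end
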